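(* Let $d\geq 2$, let $S\subset \Lambda\subset \mathbb Z^d$ and $p\in (0,1)$. For every $o\in S$ and every $x\in \Lambda$, $$\tau_{\Lambda,p}(o,x)\;\geq\; \tau_{S,p}(o,x)+ \sum_{\substack{u\in S,\ v\notin S\\ u \sim v}}\mathbb E_p\Big[\mathbf{1}\{o\xleftrightarrow{S}u\} \cdot p \cdot \tau_{\Lambda\setminus\mathcal C(u;\Lambda),\,p}(v,x)\Big],$$ where $\mathcal C(u;\Lambda)$ denotes the cluster of $u$ in $\Lambda$.
   Context: Setting: $\mathcal E$ is a fixed edge set on $\mathbb Z^d$, either nearest-neighbour, $\mathcal E=\{\{x,y\}:\|x-y\|_1=1\}$, or spread-out with parameter $L\ge 1$, $\mathcal E=\{\{x,y\}: x\neq y,\ \|x-y\|_1\le L\}$. Write $x\sim y$ if $\{x,y\}\in\mathcal E$. $\mathbb P_p$ (expectation $\mathbb E_p$) is Bernoulli bond percolation: each edge of $\mathcal E$ is open independently with probability $p$ and closed otherwise. For $S\subset\mathbb Z^d$, $\{x\xleftrightarrow{S}y\}$ is the event that there is an open path from $x$ to $y$ all of whose vertices (including $x$ and $y$) lie in $S$; thus it does not occur if $x\notin S$ or $y\notin S$. $\tau_{S,p}(x,y):=\mathbb P_p[x\xleftrightarrow{S}y]$. For $\Lambda\subset\mathbb Z^d$ and $u\in\Lambda$, $\mathcal C(u;\Lambda):=\{y: u\xleftrightarrow{\Lambda}y\}$ is the (random) cluster of $u$ in percolation restricted to $\Lambda$. In the claim, $\tau_{\Lambda\setminus\mathcal C(u;\Lambda),p}(v,x)$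 is the deterministic function $A\mapsto\tau_{\Lambda\setminus A,p}(v,x)$ evaluated at the random set $A=\mathcal C(u;\Lambda)$. *)

theory Defs
  imports "HOL-Probability.Probability"
begin

type_synonym 'd lattice = "int ^ 'd"
type_synonym 'd edge = "'d lattice set"
type_synonym 'd config = "'d edge \<Rightarrow> bool"

definition l1_norm :: "'d::finite lattice \<Rightarrow> int" where
  "l1_norm x = (\<Sum>i\<in>UNIV. \<bar>x $ i\<bar>)"

definition nn_edges :: "'d::finite edge set" where
  "nn_edges = {{x, y} | x y. l1_norm (x - y) = 1}"

definition spread_out_edges :: "real \<Rightarrow> 'd::finite edge set" where
  "spread_out_edges L = {{x, y} | x y. x \<noteq> y \<and> real_of_int (l1_norm (x - y)) \<le> L}"

definition admissible_edges :: "'d::finite edge set \<Rightarrow> bool" where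
  "admissible_edges \<E> \<longleftrightarrow> \<E> = nn_edges \<or> (\<exists>L\<ge>1. \<E> = spread_out_edges L)"

text \<open>A configuration assigns \<^term>\<open>True\<close> to the open edges of \<open>\<E>\<close>.\<close>

definition percolation :: "'d::finite edge set \<Rightarrow> real \<Rightarrow> 'd config measure" where
  "percolation \<E> p = (\<Pi>\<^sub>M e\<in>\<E>. measure_pmf (bernoulli_pmf p))"

text \<open>A path is given by its list of vertices; the one-vertex list is a path, so \<open>x\<close> is
  connected to itself in \<open>S\<close> exactly when \<open>x \<in> S\<close>.\<close>

definition open_path_in ::
  "'d::finite edge set \<Rightarrow> 'd config \<Rightarrow> 'd lattice set \<Rightarrow> 'd lattice list \<Rightarrow> bool" where
  "open_path_in \<E> \<omega> S xs \<longleftrightarrow>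
     xs \<noteq> [] \<and> set xs \<subseteq> S \<and> successively (\<lambda>a b. {a, b} \<in> \<E> \<and> \<omega> {a, b}) xs"

definition connected_in ::
  "'d::finite edge set \<Rightarrow> 'd config \<Rightarrow> 'd lattice set \<Rightarrow> 'd lattice \<Rightarrow> 'd lattice \<Rightarrow> bool" where
  "connected_in \<E> \<omega> S x y \<longleftrightarrow> (\<exists>xs. open_path_in \<E> \<omega> S xs \<and> hd xs = x \<and> last xs = y)"

definition cluster ::
  "'d::finite edge set \<Rightarrow> 'd config \<Rightarrow> 'd lattice \<Rightarrow> 'd lattice set \<Rightarrow> 'd lattice set" where
  "cluster \<E> \<omega> u \<Lambda> = {y. connected_in \<E> \<omega> \<Lambda> u y}"

definition two_point ::
  "'d::finite edge set \<Rightarrow> 'd lattice set \<Rightarrow> real \<Rightarrow> 'd lattice \<Rightarrow> 'd lattice \<Rightarrow> real" where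
  "two_point \<E> S p x y = \<P>(\<omega> in percolation \<E> p. connected_in \<E> \<omega> S x y)"

end

theory Submission
  imports Defs
begin

text \<open>
  Call an oriented edge \<open>(u, v)\<close> leaving \<open>S\<close> an \<^emph>\<open>exit bridge\<close> if it is open, \<open>a\<close> is connected to \<open>u\<close>
  inside \<open>S\<close>, and \<open>v\<close> is connected to \<open>x\<close> in \<open>\<Lambda>\<close> outside \<open>A\<close>, where \<open>A\<close> is the cluster of \<open>a\<close> in
  \<open>\<Lambda>\<close> after the edge \<open>{u, v}\<close> has been deleted. Such an edge is pivotal: every open path from \<open>a\<close>
  to \<open>x\<close> in \<open>\<Lambda>\<close> crosses it.

  If an exit bridge exists, or if \<open>a\<close> is connected to \<open>x\<close> inside \<open>S\<close>, then \<open>a\<close> is connected to \<open>x\<close> in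
  \<open>\<Lambda>\<close>. All these events are mutually exclusive. A connection inside \<open>S\<close> cannot use
  \<open>{u, v}\<close>, because \<open>v\<close> is not in \<open>S\<close>; and of two distinct pivotal edges the second one on the way
  to \<open>x\<close> lies beyond the first, so its tail could not be reached inside \<open>S\<close>
  (\<open>exit_bridge_unique\<close>). Hence the probability that \<open>a\<close> is connected to \<open>x\<close> in \<open>\<Lambda>\<close> is at least
  the probability of a connection inside \<open>S\<close> plus the sum of the exit bridge probabilities.

  It remains to bound each term of the sum by the probability that \<open>(u, v)\<close> is an exit bridge. On
  the event that \<open>a\<close> is connected to \<open>u\<close> inside \<open>S\<close>, the set \<open>A\<close> is contained in the cluster of
  \<open>u\<close>, so the term only grows when that cluster is replaced by \<open>A\<close>. The gain is that \<open>A\<close> does not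
  depend on the state of \<open>{u, v}\<close>, which therefore contributes the factor \<open>p\<close> by independence.
  For the factor \<open>two_point\<close> one would like to condition on \<open>A\<close>, which may be infinite. This is
  avoided by fixing a finite \<open>D \<subseteq> \<Lambda>\<close> and recording only \<open>B = A \<inter> D\<close>: whether \<open>A \<inter> D = B\<close> is
  decided without looking at the edges inside \<open>D - B\<close> (\<open>explored_depends\<close>), while the connection
  of \<open>v\<close> to \<open>x\<close> in \<open>D - B\<close> uses only these edges. Summing over the finitely many \<open>B\<close> gives
  the bound with \<open>D\<close> in place of \<open>\<Lambda>\<close>, and monotone convergence lets \<open>D\<close> increase to \<open>\<Lambda>\<close>.
\<close>

section \<open>Connections inside a vertex set\<close>

definition open_step ::
  "'d::finite edge set \<Rightarrow> 'd config \<Rightarrow> 'd lattice set \<Rightarrow> 'd lattice \<Rightarrow> 'd lattice \<Rightarrow> bool" where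
  "open_step E \<omega> S b c \<longleftrightarrow> b \<in> S \<and> c \<in> S \<and> {b, c} \<in> E \<and> \<omega> {b, c}"

lemma connected_in_iff_rtranclp:
  "connected_in E \<omega> S x y \<longleftrightarrow> x \<in> S \<and> (open_step E \<omega> S)\<^sup>*\<^sup>* x y"
proof
  have path: "xs \<noteq> [] \<Longrightarrow> set xs \<subseteq> S \<Longrightarrow> successively (\<lambda>a b. {a, b} \<in> E \<and> \<omega> {a, b}) xs
    \<Longrightarrow> (open_step E \<omega> S)\<^sup>*\<^sup>* (hd xs) (last xs)" for xs
  proof (induction xs)
    case (Cons a ys)
    show ?case
    proof (cases "ys = []")
      case False
      with Cons.prems have "open_step E \<omega> S a (hd ys)"
        by (auto simp: successively_Cons open_step_def)
      moreover have "(open_step E \<omega> S)\<^sup>*\<^sup>* (hd ys) (last ys)"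
        using Cons.IH Cons.prems False by (auto simp: successively_Cons)
      ultimately show ?thesis using False by (simp add: converse_rtranclp_into_rtranclp)
    qed simp
  qed simp
  assume "connected_in E \<omega> S x y"
  then obtain xs where xs: "xs \<noteq> []" "set xs \<subseteq> S"
      "successively (\<lambda>a b. {a, b} \<in> E \<and> \<omega> {a, b}) xs" "hd xs = x" "last xs = y"
    unfolding connected_in_def open_path_in_def by auto
  show "x \<in> S \<and> (open_step E \<omega> S)\<^sup>*\<^sup>* x y"
    using path[OF xs(1-3)] hd_in_set[OF xs(1)] xs(2,4,5) by auto
next
  assume "x \<in> S \<and> (open_step E \<omega> S)\<^sup>*\<^sup>* x y"
  then have "(open_step E \<omega> S)\<^sup>*\<^sup>* x y" "x \<in> S" by auto
  then show "connected_in E \<omega> S x y"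
  proof (induction rule: rtranclp_induct)
    case base
    then show ?case
      unfolding connected_in_def open_path_in_def by (intro exI[of _ "[x]"]) auto
  next
    case (step b c)
    then obtain xs where "open_path_in E \<omega> S xs" "hd xs = x" "last xs = b"
      unfolding connected_in_def by auto
    with step.hyps(2) show ?case
      unfolding connected_in_def open_path_in_def
      by (intro exI[of _ "xs @ [c]"]) (auto simp: successively_append_iff open_step_def)
  qed
qed

lemma connected_in_refl: "x \<in> S \<Longrightarrow> connected_in E \<omega> S x x"
  by (simp add: connected_in_iff_rtranclp)

lemma connected_in_step:
  "connected_in E \<omega> S x b \<Longrightarrow> open_step E \<omega> S b c \<Longrightarrow> connected_in E \<omega> S x c"
  by (auto simp: connected_in_iff_rtranclp)

lemma connected_in_induct [consumes 1, case_names refl step]: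
  assumes "connected_in E \<omega> S x y"
    and "x \<in> S \<Longrightarrow> P x"
    and "\<And>b c. connected_in E \<omega> S x b \<Longrightarrow> open_step E \<omega> S b c \<Longrightarrow> P b \<Longrightarrow> P c"
  shows "P y"
proof -
  have "(open_step E \<omega> S)\<^sup>*\<^sup>* x y" and x: "x \<in> S"
    using assms(1) by (auto simp: connected_in_iff_rtranclp)
  then show ?thesis
  proof (induction rule: rtranclp_induct)
    case (step b c)
    show ?case
      by (rule assms(3)[OF _ step.hyps(2) step.IH[OF x]])
         (simp add: connected_in_iff_rtranclp step.hyps x)
  qed (use assms(2) x in auto)
qed

lemma connected_in_endpoints:
  assumes "connected_in E \<omega> S x y"
  shows "x \<in> S" "y \<in> S"
  using assms by (auto simp: connected_in_def open_path_in_def)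

lemma connected_in_trans:
  "connected_in E \<omega> S x y \<Longrightarrow> connected_in E \<omega> S y z \<Longrightarrow> connected_in E \<omega> S x z"
  by (auto simp: connected_in_iff_rtranclp)

lemma connected_in_sym:
  assumes "connected_in E \<omega> S x y"
  shows "connected_in E \<omega> S y x"
proof -
  have "symp (open_step E \<omega> S)"
    by (auto simp: symp_def open_step_def insert_commute)
  then show ?thesis
    using assms connected_in_endpoints(2)[OF assms]
    by (auto simp: connected_in_iff_rtranclp dest: sympD[OF symp_rtranclp])
qed

text \<open>Edges, configuration and vertex set may change simultaneously, as long as the open edges inside
  the smaller vertex set survive. In this form the lemma covers enlarging the vertex set, deleting an
  edge with an endpoint outside it, and changing the state of such an edge.\<close>

lemma connected_in_mono:
  assumes "connected_in E \<omega> S x y"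
    and "\<And>e. e \<in> E \<Longrightarrow> e \<subseteq> S \<Longrightarrow> \<omega> e \<Longrightarrow> e \<in> E' \<and> \<omega>' e"
    and "S \<subseteq> S'"
  shows "connected_in E' \<omega>' S' x y"
  using assms(1)
proof (induction rule: connected_in_induct)
  case refl
  then show ?case using assms(3) by (auto intro: connected_in_refl)
next
  case (step b c)
  have "open_step E' \<omega>' S' b c"
    using step.hyps(2) assms(2)[of "{b, c}"] assms(3) by (auto simp: open_step_def)
  with step.IH show ?case by (rule connected_in_step)
qed

lemma connected_in_cong:
  assumes "\<And>e. e \<subseteq> S \<Longrightarrow> e \<in> E \<and> \<omega> e \<longleftrightarrow> e \<in> E' \<and> \<omega>' e"
  shows "connected_in E \<omega> S = connected_in E' \<omega>' S"
  using assms by (intro ext iffI) (auto elim!: connected_in_mono)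

section \<open>The cluster does not see the edges in the region that it avoids\<close>

text \<open>An edge inside \<open>W\<close> can be used only after \<open>W\<close> has been entered. If the cluster computed
  without these edges never enters \<open>W\<close>, restoring them does not help. The hypothesis is on the
  cluster in the smaller edge set, so it is itself independent of the edges inside \<open>W\<close>.\<close>

lemma connected_in_Diff_edges_not_meeting_cluster:
  assumes "cluster (E - Pow W) \<omega> a \<Lambda> \<inter> W = {}" and "S \<subseteq> \<Lambda>"
  shows "connected_in (E - Pow W) \<omega> S a = connected_in E \<omega> S a"
proof (intro ext iffI)
  fix y
  assume "connected_in E \<omega> S a y"
  then show "connected_in (E - Pow W) \<omega> S a y"
  proof (induction rule: connected_in_induct)
    case refl
    then show ?case by (rule connected_in_refl)
  next
    case (step b c)
    from step.IH have "b \<in> cluster (E - Pow W) \<omega> a \<Lambda>"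
      unfolding cluster_def using assms(2) by (auto elim!: connected_in_mono)
    with assms(1) have "b \<notin> W" by auto
    with step.hyps(2) have "open_step (E - Pow W) \<omega> S b c"
      by (auto simp: open_step_def)
    with step.IH show ?case by (rule connected_in_step)
  qed
qed (auto elim!: connected_in_mono)

text \<open>The trace \<open>B\<close> of the cluster on \<open>D\<close> says in particular that the cluster avoids \<open>D - B\<close>. If it
  already enters \<open>D - B\<close> without the edges there, both sides are false; otherwise these
  edges change nothing.\<close>

lemma cluster_Int_eq_Diff_edges:
  assumes "W = D - B" and "S \<subseteq> \<Lambda>"
  shows "connected_in E \<omega> S a u \<and> cluster E \<omega> a \<Lambda> \<inter> D = B \<longleftrightarrow>
    connected_in (E - Pow W) \<omega> S a u \<and> cluster (E - Pow W) \<omega> a \<Lambda> \<inter> D = B"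
proof (cases "cluster (E - Pow W) \<omega> a \<Lambda> \<inter> W = {}")
  case True
  have "connected_in (E - Pow W) \<omega> S a = connected_in E \<omega> S a"
    and "connected_in (E - Pow W) \<omega> \<Lambda> a = connected_in E \<omega> \<Lambda> a"
    using connected_in_Diff_edges_not_meeting_cluster[OF True] assms(2) by auto
  then show ?thesis by (simp add: cluster_def)
next
  case False
  have "cluster (E - Pow W) \<omega> a \<Lambda> \<subseteq> cluster E \<omega> a \<Lambda>"
    by (auto simp: cluster_def elim!: connected_in_mono)
  with False assms(1) show ?thesis by blast
qed

section \<open>Exit bridges\<close>

text \<open>The edge \<open>{u, v}\<close> is deleted before taking the cluster, so that for \<open>v \<notin> S\<close> the two connection
  requirements together do not depend on its state and the requirement that it is open is an
  independent factor.\<close>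

definition exit_bridge ::
  "'d::finite edge set \<Rightarrow> 'd lattice set \<Rightarrow> 'd lattice set \<Rightarrow> 'd lattice \<Rightarrow> 'd lattice \<Rightarrow>
    'd lattice \<times> 'd lattice \<Rightarrow> 'd config \<Rightarrow> bool" where
  "exit_bridge E S \<Lambda> a x = (\<lambda>(u, v) \<omega>. \<omega> {u, v} \<and> connected_in E \<omega> S a u \<and>
     connected_in E \<omega> (\<Lambda> - cluster (E - {{u, v}}) \<omega> a \<Lambda>) v x)"

definition exit_edges :: "'d::finite edge set \<Rightarrow> 'd lattice set \<Rightarrow> ('d lattice \<times> 'd lattice) set" where
  "exit_edges E S = {(u, v). u \<in> S \<and> v \<notin> S \<and> {u, v} \<in> E}"

lemma connected_in_Diff_exit_edge:
  assumes "connected_in E \<omega> S a y" "v \<notin> S" "S \<subseteq> \<Lambda>"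
  shows "connected_in (E - {{u, v}}) \<omega> \<Lambda> a y"
  using assms by (auto elim!: connected_in_mono)

lemma exit_bridge_imp_not_in_cluster:
  "exit_bridge E S \<Lambda> a x (u, v) \<omega> \<Longrightarrow> \<not> connected_in (E - {{u, v}}) \<omega> \<Lambda> a x"
  by (auto simp: exit_bridge_def cluster_def dest: connected_in_endpoints(2))

lemma exit_bridge_imp_connected:
  assumes "exit_bridge E S \<Lambda> a x (u, v) \<omega>" "{u, v} \<in> E" "S \<subseteq> \<Lambda>"
  shows "connected_in E \<omega> \<Lambda> a x"
proof -
  from assms(1) have *: "\<omega> {u, v}" "connected_in E \<omega> S a u"
    "connected_in E \<omega> (\<Lambda> - cluster (E - {{u, v}}) \<omega> a \<Lambda>) v x"
    by (auto simp: exit_bridge_def)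
  from *(2) have au: "connected_in E \<omega> \<Lambda> a u" using assms(3) by (auto elim!: connected_in_mono)
  from *(3) have vx: "connected_in E \<omega> \<Lambda> v x" by (auto elim!: connected_in_mono)
  have "open_step E \<omega> \<Lambda> u v"
    using *(1) assms(2) au vx by (auto simp: open_step_def dest: connected_in_endpoints)
  with au vx show ?thesis by (blast intro: connected_in_step connected_in_trans)
qed

text \<open>After deleting \<open>{u, v}\<close>, the vertex \<open>a\<close> still reaches \<open>u'\<close> inside \<open>S\<close> and then \<open>v'\<close> through the
  open edge \<open>{u', v'}\<close>. The vertex \<open>u\<close> belongs to the cluster of \<open>a\<close> without
  \<open>{u', v'}\<close>, so the connection from \<open>v'\<close> to \<open>x\<close> avoids \<open>u\<close> and does not use \<open>{u, v}\<close> either. Thus \<open>a\<close> reaches \<open>x\<close> without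
  \<open>{u, v}\<close>, and \<open>{u, v}\<close> is not an exit bridge.\<close>

lemma exit_bridge_unique:
  assumes e: "(u, v) \<in> exit_edges E S" and e': "(u', v') \<in> exit_edges E S" and "S \<subseteq> \<Lambda>"
    and b: "exit_bridge E S \<Lambda> a x (u, v) \<omega>" and b': "exit_bridge E S \<Lambda> a x (u', v') \<omega>"
  shows "(u', v') = (u, v)"
proof (rule ccontr)
  assume "(u', v') \<noteq> (u, v)"
  \<comment> \<open>Only one endpoint of each edge is in \<open>S\<close>, so different pairs are different unoriented edges.\<close>
  with e e' have ne: "{u', v'} \<noteq> {u, v}"
    by (auto simp: exit_edges_def doubleton_eq_iff)
  let ?A' = "cluster (E - {{u', v'}}) \<omega> a \<Lambda>"
  from b b' have au: "connected_in E \<omega> S a u" and au': "connected_in E \<omega> S a u'"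
    and v'x: "connected_in E \<omega> (\<Lambda> - ?A') v' x" and op: "\<omega> {u', v'}"
    by (auto simp: exit_bridge_def)
  from e e' have vS: "v \<notin> S" "v' \<notin> S" and "{u', v'} \<in> E" by (auto simp: exit_edges_def)
  have u': "connected_in (E - {{u, v}}) \<omega> \<Lambda> a u'"
    using connected_in_Diff_exit_edge[OF au' vS(1) \<open>S \<subseteq> \<Lambda>\<close>] .
  have "u \<in> ?A'"
    using connected_in_Diff_exit_edge[OF au vS(2) \<open>S \<subseteq> \<Lambda>\<close>] by (simp add: cluster_def)
  with v'x have "connected_in (E - {{u, v}}) \<omega> \<Lambda> v' x"
    by (auto elim!: connected_in_mono)
  moreover have "connected_in (E - {{u, v}}) \<omega> \<Lambda> a v'"
    using u' op \<open>{u', v'} \<in> E\<close> ne calculation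
    by (auto intro!: connected_in_step[OF u'] simp: open_step_def dest: connected_in_endpoints)
  ultimately show False
    using exit_bridge_imp_not_in_cluster[OF b] connected_in_trans by blast
qed

section \<open>Measurability\<close>

lemma prob_space_percolation: "prob_space (percolation E p)"
  unfolding percolation_def by (intro prob_space_PiM prob_space_measure_pmf)

lemma pred_edge_open:
  assumes "e \<in> E"
  shows "Measurable.pred (percolation E p) (\<lambda>\<omega>. \<omega> e)"
proof -
  have "(\<lambda>\<omega>. \<omega> e) \<in> measurable (percolation E p) (measure_pmf (bernoulli_pmf p))"
    unfolding percolation_def by (rule measurable_component_singleton[OF assms])
  then show ?thesis by simp
qed

lemma pred_open_path_in:
  assumes "E' \<subseteq> E"
  shows "Measurable.pred (percolation E p) (\<lambda>\<omega>. open_path_in E' \<omega> S xs)"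
proof -
  have edge: "Measurable.pred (percolation E p) (\<lambda>\<omega>. e \<in> E' \<and> \<omega> e)" for e
    using assms pred_edge_open[of e E p] by (cases "e \<in> E'") auto
  have "Measurable.pred (percolation E p) (\<lambda>\<omega>. successively (\<lambda>a b. {a, b} \<in> E' \<and> \<omega> {a, b}) xs)"
  proof (induction xs)
    case (Cons a ys)
    then show ?case
      unfolding successively_Cons by (intro pred_intros_logic edge) auto
  qed simp
  then show ?thesis
    unfolding open_path_in_def by (intro pred_intros_logic) auto
qed

lemma pred_connected_in:
  "E' \<subseteq> E \<Longrightarrow> Measurable.pred (percolation E p) (\<lambda>\<omega>. connected_in E' \<omega> S x y)"
  unfolding connected_in_def
  by (intro pred_intros_countable pred_intros_logic pred_open_path_in) auto

lemma emeasure_connected_in: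
  "emeasure (percolation E p) {\<omega> \<in> space (percolation E p). connected_in E \<omega> S x y} =
   ennreal (two_point E S p x y)"
  unfolding two_point_def
  by (simp add: prob_space.finite_measure prob_space_percolation finite_measure.emeasure_eq_measure)

text \<open>Moving the excluded set \<open>C\<close> from the vertex set to a separate condition on the finitely many
  vertices of the path makes the event measurable also for a random \<open>C\<close>.\<close>

lemma connected_in_Diff_iff:
  "connected_in E \<omega> (\<Lambda> - C) x y \<longleftrightarrow>
     (\<exists>xs. open_path_in E \<omega> \<Lambda> xs \<and> hd xs = x \<and> last xs = y \<and> (\<forall>z\<in>set xs. z \<notin> C))"
  unfolding connected_in_def open_path_in_def by blast

lemma pred_connected_in_off_cluster:
  assumes "E' \<subseteq> E"
  shows "Measurable.pred (percolation E p) (\<lambda>\<omega>. connected_in E \<omega> (\<Lambda> - cluster E' \<omega> a \<Lambda>) v x)"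
  unfolding connected_in_Diff_iff cluster_def mem_Collect_eq
  by (intro pred_intros_countable pred_intros_countable_bounded pred_intros_logic
      pred_open_path_in pred_connected_in assms) auto

lemma pred_exit_bridge:
  assumes "uv \<in> exit_edges E S"
  shows "Measurable.pred (percolation E p) (exit_bridge E S \<Lambda> a x uv)"
proof -
  obtain u v where uv: "uv = (u, v)" "{u, v} \<in> E"
    using assms by (auto simp: exit_edges_def)
  show ?thesis
    unfolding uv(1) exit_bridge_def prod.case
    by (intro pred_intros_logic pred_edge_open uv(2) pred_connected_in
        pred_connected_in_off_cluster) auto
qed

lemma sets_exit_bridge:
  shows "uv \<in> exit_edges E S \<Longrightarrow>
      {\<omega> \<in> space (percolation E p). exit_bridge E S \<Lambda> a x uv \<omega>} \<in> sets (percolation E p)"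
    and "{\<omega> \<in> space (percolation E p). \<exists>uv\<in>exit_edges E S. exit_bridge E S \<Lambda> a x uv \<omega>}
      \<in> sets (percolation E p)"
proof -
  have "Measurable.pred (percolation E p) (\<lambda>\<omega>. \<exists>uv\<in>exit_edges E S. exit_bridge E S \<Lambda> a x uv \<omega>)"
    by (intro pred_intros_countable_bounded pred_exit_bridge)
  then show "{\<omega> \<in> space (percolation E p). \<exists>uv\<in>exit_edges E S. exit_bridge E S \<Lambda> a x uv \<omega>}
      \<in> sets (percolation E p)" by (simp add: pred_def)
qed (auto simp: pred_def[symmetric] intro: pred_exit_bridge)

section \<open>Independence of events on disjoint sets of edges\<close>

lemma prob_edge_open:
  assumes "e \<in> E" "0 \<le> p" "p \<le> 1"
  shows "\<P>(\<omega> in percolation E p. \<omega> e) = p"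
proof -
  interpret product_prob_space "\<lambda>_. measure_pmf (bernoulli_pmf p)" E
    by unfold_locales
  have "emeasure (percolation E p) {\<omega> \<in> space (percolation E p). \<omega> e \<in> {True}} =
      emeasure (measure_pmf (bernoulli_pmf p)) {True}"
    unfolding percolation_def by (rule emeasure_PiM_Collect_single[OF assms(1)]) simp
  then show ?thesis
    using assms by (simp add: measure_def emeasure_pmf_single)
qed

lemma indep_vars_edges:
  assumes "E \<noteq> {}"
  shows "prob_space.indep_vars (percolation E p) (\<lambda>_. measure_pmf (bernoulli_pmf p)) (\<lambda>e \<omega>. \<omega> e) E"
proof -
  let ?B = "\<lambda>_. measure_pmf (bernoulli_pmf p)"
  interpret prob_space "percolation E p" by (rule prob_space_percolation)
  have rv: "random_variable (?B e) (\<lambda>\<omega>. \<omega> e)" if "e \<in> E" for e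
    unfolding percolation_def by (rule measurable_component_singleton[OF that])
  have "distr (percolation E p) (Pi\<^sub>M E ?B) (\<lambda>\<omega>. \<lambda>e\<in>E. \<omega> e) =
      distr (percolation E p) (percolation E p) (\<lambda>\<omega>. \<omega>)"
    by (intro distr_cong) (auto simp: percolation_def space_PiM PiE_def extensional_restrict)
  also have "\<dots> = (\<Pi>\<^sub>M e\<in>E. distr (percolation E p) (?B e) (\<lambda>\<omega>. \<omega> e))"
    unfolding distr_id percolation_def
    by (intro PiM_cong refl distr_PiM_component[symmetric] prob_space_measure_pmf)
  finally show ?thesis
    by (subst indep_vars_iff_distr_eq_PiM'[OF assms rv]) auto
qed

text \<open>An event that depends only on the edges in a set \<open>J\<close> is a preimage under restriction to \<open>J\<close>,
  and the restrictions to disjoint edge sets are independent.\<close>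

lemma prob_conj_disjoint_edges:
  assumes K: "K \<subseteq> E"
    and P: "Measurable.pred (percolation E p) P" and Q: "Measurable.pred (percolation E p) Q"
    and PK: "\<And>\<omega> \<omega>'. (\<And>e. e \<in> K \<Longrightarrow> \<omega> e = \<omega>' e) \<Longrightarrow> P \<omega> = P \<omega>'"
    and QK: "\<And>\<omega> \<omega>'. (\<And>e. e \<in> E - K \<Longrightarrow> \<omega> e = \<omega>' e) \<Longrightarrow> Q \<omega> = Q \<omega>'"
  shows "\<P>(\<omega> in percolation E p. P \<omega> \<and> Q \<omega>) =
    \<P>(\<omega> in percolation E p. P \<omega>) * \<P>(\<omega> in percolation E p. Q \<omega>)"
proof (cases "E = {}")
  case True
  interpret prob_space "percolation E p" by (rule prob_space_percolation)
  have "P \<omega> = P (\<lambda>_. False)" for \<omega> by (rule PK) (use K True in auto)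
  then show ?thesis by (cases "P (\<lambda>_. False)") (simp_all add: prob_space)
next
  case False
  let ?B = "\<lambda>_. measure_pmf (bernoulli_pmf p)"
  interpret prob_space "percolation E p" by (rule prob_space_percolation)
  have cylinder: "\<exists>X \<in> sets (Pi\<^sub>M J ?B). \<forall>\<omega>. R \<omega> \<longleftrightarrow> restrict \<omega> J \<in> X"
    if J: "J \<subseteq> E" and R: "Measurable.pred (percolation E p) R"
      and RJ: "\<And>\<omega> \<omega>'. (\<And>e. e \<in> J \<Longrightarrow> \<omega> e = \<omega>' e) \<Longrightarrow> R \<omega> = R \<omega>'"
    for J R
  proof
    \<comment> \<open>The values outside \<open>J\<close> are arbitrary; closing these edges gives a measurable extension.\<close>
    let ?ext = "\<lambda>\<omega>. \<lambda>e\<in>E. if e \<in> J then \<omega> e else False"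
    have "(\<lambda>\<omega>. if e \<in> J then \<omega> e else False) \<in> measurable (Pi\<^sub>M J ?B) (measure_pmf (bernoulli_pmf p))" for e
      by (cases "e \<in> J") (auto intro: measurable_component_singleton)
    then have "?ext \<in> measurable (Pi\<^sub>M J ?B) (percolation E p)"
      unfolding percolation_def by (intro measurable_restrict)
    then have "Measurable.pred (Pi\<^sub>M J ?B) (\<lambda>\<omega>. R (?ext \<omega>))"
      using R by (rule measurable_compose)
    then show "{\<omega> \<in> space (Pi\<^sub>M J ?B). R (?ext \<omega>)} \<in> sets (Pi\<^sub>M J ?B)"
      by (simp add: pred_def)
    show "\<forall>\<omega>. R \<omega> \<longleftrightarrow> restrict \<omega> J \<in> {\<omega> \<in> space (Pi\<^sub>M J ?B). R (?ext \<omega>)}"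
    proof
      fix \<omega>
      have "R \<omega> = R (?ext (restrict \<omega> J))"
        by (rule RJ) (use J in auto)
      then show "R \<omega> \<longleftrightarrow> restrict \<omega> J \<in> {\<omega> \<in> space (Pi\<^sub>M J ?B). R (?ext \<omega>)}"
        by (simp add: space_PiM)
    qed
  qed
  have "\<exists>X \<in> sets (Pi\<^sub>M K ?B). \<forall>\<omega>. P \<omega> \<longleftrightarrow> restrict \<omega> K \<in> X"
    by (rule cylinder[OF K P]) (fact PK)
  then obtain X where X: "X \<in> sets (Pi\<^sub>M K ?B)" "\<And>\<omega>. P \<omega> \<longleftrightarrow> restrict \<omega> K \<in> X"
    by (elim bexE) simp
  have "\<exists>Y \<in> sets (Pi\<^sub>M (E - K) ?B). \<forall>\<omega>. Q \<omega> \<longleftrightarrow> restrict \<omega> (E - K) \<in> Y"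
    by (rule cylinder[OF Diff_subset Q]) (fact QK)
  then obtain Y where Y: "Y \<in> sets (Pi\<^sub>M (E - K) ?B)" "\<And>\<omega>. Q \<omega> \<longleftrightarrow> restrict \<omega> (E - K) \<in> Y"
    by (elim bexE) simp
  have "indep_var (Pi\<^sub>M K ?B) (\<lambda>\<omega>. restrict (\<lambda>e. \<omega> e) K) (Pi\<^sub>M (E - K) ?B) (\<lambda>\<omega>. restrict (\<lambda>e. \<omega> e) (E - K))"
    by (rule indep_var_restrict[OF indep_vars_edges[OF False]]) (use K in auto)
  note indep_varD[OF this X(1) Y(1)]
  moreover have "(\<lambda>\<omega>. (restrict \<omega> K, restrict \<omega> (E - K))) -` (X \<times> Y) \<inter> space (percolation E p) =
      {\<omega> \<in> space (percolation E p). P \<omega> \<and> Q \<omega>}"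
    and "(\<lambda>\<omega>. restrict \<omega> K) -` X \<inter> space (percolation E p) = {\<omega> \<in> space (percolation E p). P \<omega>}"
    and "(\<lambda>\<omega>. restrict \<omega> (E - K)) -` Y \<inter> space (percolation E p) = {\<omega> \<in> space (percolation E p). Q \<omega>}"
    using X(2) Y(2) by blast+
  ultimately show ?thesis by simp
qed

section \<open>Continuity of the two-point function in the vertex set\<close>

lemma connected_in_UN_incseq:
  assumes "incseq A"
  shows "connected_in E \<omega> (\<Union>n. A n) x y \<longleftrightarrow> (\<exists>n. connected_in E \<omega> (A n) x y)"
proof
  assume "connected_in E \<omega> (\<Union>n. A n) x y"
  then show "\<exists>n. connected_in E \<omega> (A n) x y"
  proof (induction rule: connected_in_induct)
    case refl
    then show ?case by (auto intro: connected_in_refl)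
  next
    case (step b c)
    from step.IH obtain n where n: "connected_in E \<omega> (A n) x b" by blast
    from step.hyps(2) obtain m where m: "c \<in> A m" by (auto simp: open_step_def)
    have mono: "A n \<subseteq> A (max n m)" "A m \<subseteq> A (max n m)"
      using assms by (auto simp: incseq_def)
    then have "connected_in E \<omega> (A (max n m)) x b"
      using n by (auto elim!: connected_in_mono)
    moreover have "open_step E \<omega> (A (max n m)) b c"
      using step.hyps(2) mono m connected_in_endpoints(2)[OF n] by (auto simp: open_step_def)
    ultimately show ?case by (blast intro: connected_in_step)
  qed
next
  show "\<exists>n. connected_in E \<omega> (A n) x y \<Longrightarrow> connected_in E \<omega> (\<Union>n. A n) x y"
    by (elim exE) (erule connected_in_mono, auto)
qed

lemma two_point_mono:
  assumes "A \<subseteq> B"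
  shows "two_point E A p x y \<le> two_point E B p x y"
proof -
  interpret prob_space "percolation E p" by (rule prob_space_percolation)
  have "connected_in E \<omega> A x y \<Longrightarrow> connected_in E \<omega> B x y" for \<omega>
    by (erule connected_in_mono) (use assms in auto)
  then show ?thesis
    unfolding two_point_def using pred_connected_in[where E = E and E' = E and p = p]
    by (intro finite_measure_mono) (auto simp: pred_def)
qed

lemma two_point_UN_incseq:
  assumes "incseq A"
  shows "ennreal (two_point E (\<Union>n. A n) p x y) = (SUP n. ennreal (two_point E (A n) p x y))"
proof -
  let ?M = "percolation E p"
  let ?X = "\<lambda>n. {\<omega> \<in> space ?M. connected_in E \<omega> (A n) x y}"
  have "(SUP n. emeasure ?M (?X n)) = emeasure ?M (\<Union>n. ?X n)"
  proof (rule SUP_emeasure_incseq)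
    show "range ?X \<subseteq> sets ?M"
      using pred_connected_in[where E = E and E' = E and p = p] by (auto simp: pred_def)
    have "connected_in E \<omega> (A m) x y \<Longrightarrow> connected_in E \<omega> (A n) x y" if "m \<le> n" for m n \<omega>
      by (erule connected_in_mono) (use that assms in \<open>auto simp: incseq_def\<close>)
    then show "incseq ?X" by (fastforce simp: incseq_def)
  qed
  also have "(\<Union>n. ?X n) = {\<omega> \<in> space ?M. connected_in E \<omega> (\<Union>n. A n) x y}"
    using connected_in_UN_incseq[OF assms] by auto
  finally show ?thesis by (simp only: emeasure_connected_in)
qed

section \<open>Averaging over the finite trace of the cluster\<close>

definition explored ::
  "'d::finite edge set \<Rightarrow> 'd lattice set \<Rightarrow> 'd lattice set \<Rightarrow> 'd lattice set \<Rightarrow> 'd lattice \<Rightarrow>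
    'd lattice \<Rightarrow> 'd lattice set \<Rightarrow> 'd config \<Rightarrow> bool" where
  "explored E S \<Lambda> D a u B \<omega> \<longleftrightarrow> connected_in E \<omega> S a u \<and> cluster E \<omega> a \<Lambda> \<inter> D = B"

lemma pred_explored:
  assumes "E' \<subseteq> E"
  shows "Measurable.pred (percolation E p) (explored E' S \<Lambda> D a u B)"
proof -
  have eq: "explored E' S \<Lambda> D a u B = (\<lambda>\<omega>. connected_in E' \<omega> S a u \<and>
      (\<forall>z. (connected_in E' \<omega> \<Lambda> a z \<and> z \<in> D \<longrightarrow> z \<in> B) \<and> (z \<in> B \<longrightarrow> connected_in E' \<omega> \<Lambda> a z \<and> z \<in> D)))"
    unfolding explored_def cluster_def by (intro ext) blast
  show ?thesis
    unfolding eq by (intro pred_intros_countable pred_intros_logic pred_connected_in assms) auto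
qed

lemma explored_depends:
  assumes "S \<subseteq> \<Lambda>" and "\<And>e. e \<in> E - Pow (D - B) \<Longrightarrow> \<omega> e = \<omega>' e"
  shows "explored E S \<Lambda> D a u B \<omega> \<longleftrightarrow> explored E S \<Lambda> D a u B \<omega>'"
proof -
  have "connected_in (E - Pow (D - B)) \<omega> T = connected_in (E - Pow (D - B)) \<omega>' T" for T
    using assms(2) by (intro connected_in_cong) auto
  then show ?thesis
    unfolding explored_def cluster_Int_eq_Diff_edges[OF refl assms(1), of E _ a u D B]
    by (simp add: cluster_def)
qed

text \<open>Three disjoint sets of edges are involved: those inside \<open>D - B\<close>, the single edge \<open>{u, v}\<close>, and
  the remaining ones, which decide \<open>F\<close>. The edge \<open>{u, v}\<close> could lie inside \<open>D - B\<close> only if \<open>u\<close> does,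
  but then \<open>F\<close> is impossible, since it puts \<open>u\<close> in the cluster.\<close>

lemma prob_explored_bridge:
  fixes E :: "'d::finite edge set"
    and S \<Lambda> D B :: "'d lattice set"
    and a u v x :: "'d lattice"
  assumes e: "{u, v} \<in> E" and "0 \<le> p" "p \<le> 1" "S \<subseteq> \<Lambda>"
  defines "F \<equiv> explored (E - {{u, v}}) S \<Lambda> D a u B"
  shows "\<P>(\<omega> in percolation E p. connected_in E \<omega> (D - B) v x \<and> \<omega> {u, v} \<and> F \<omega>) =
    two_point E (D - B) p v x * (p * \<P>(\<omega> in percolation E p. F \<omega>))"
proof (cases "u \<in> D - B")
  case True
  have "\<not> F \<omega>" for \<omega>
  proof
    assume F: "F \<omega>"
    then have "connected_in (E - {{u, v}}) \<omega> \<Lambda> a u"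
      unfolding F_def explored_def using \<open>S \<subseteq> \<Lambda>\<close> by (auto elim!: connected_in_mono)
    with F True show False
      unfolding F_def explored_def cluster_def by auto
  qed
  then show ?thesis by simp
next
  case False
  have F: "Measurable.pred (percolation E p) F"
    unfolding F_def by (rule pred_explored) auto
  have F_dep: "F \<omega> = F \<omega>'" if "\<And>e. e \<in> E - {{u, v}} - Pow (D - B) \<Longrightarrow> \<omega> e = \<omega>' e" for \<omega> \<omega>'
    unfolding F_def by (rule explored_depends[OF \<open>S \<subseteq> \<Lambda>\<close> that])
  have "\<P>(\<omega> in percolation E p. connected_in E \<omega> (D - B) v x \<and> (\<omega> {u, v} \<and> F \<omega>)) =
    \<P>(\<omega> in percolation E p. connected_in E \<omega> (D - B) v x) *
    \<P>(\<omega> in percolation E p. \<omega> {u, v} \<and> F \<omega>)"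
  proof (rule prob_conj_disjoint_edges[where K = "E \<inter> Pow (D - B)"])
    show "Measurable.pred (percolation E p) (\<lambda>\<omega>. \<omega> {u, v} \<and> F \<omega>)"
      by (intro pred_intros_logic pred_edge_open e F)
    show "connected_in E \<omega> (D - B) v x = connected_in E \<omega>' (D - B) v x"
      if "\<And>e. e \<in> E \<inter> Pow (D - B) \<Longrightarrow> \<omega> e = \<omega>' e" for \<omega> \<omega>'
    proof -
      have "connected_in E \<omega> (D - B) = connected_in E \<omega>' (D - B)"
        using that by (intro connected_in_cong) auto
      then show ?thesis by simp
    qed
    show "(\<omega> {u, v} \<and> F \<omega>) = (\<omega>' {u, v} \<and> F \<omega>')"
      if "\<And>e. e \<in> E - E \<inter> Pow (D - B) \<Longrightarrow> \<omega> e = \<omega>' e" for \<omega> \<omega>'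
      using F_dep[of \<omega> \<omega>'] that e False by auto
  qed (auto intro: pred_connected_in)
  also have "\<P>(\<omega> in percolation E p. \<omega> {u, v} \<and> F \<omega>) =
      \<P>(\<omega> in percolation E p. \<omega> {u, v}) * \<P>(\<omega> in percolation E p. F \<omega>)"
  proof (rule prob_conj_disjoint_edges[where K = "{{u, v}}"])
    show "F \<omega> = F \<omega>'" if "\<And>e. e \<in> E - {{u, v}} \<Longrightarrow> \<omega> e = \<omega>' e" for \<omega> \<omega>'
      using that by (intro F_dep) auto
  qed (use e F in \<open>auto intro: pred_edge_open\<close>)
  finally show ?thesis
    using assms by (simp add: prob_edge_open two_point_def)
qed

text \<open>The integrand is a finite sum over the possible traces \<open>B\<close> of the cluster on \<open>D\<close>. The integral
  of a summand is the probability of an event contained in the exit bridge event, and different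
  traces give disjoint events. Measurability is part of the conclusion because the passage to infinite \<open>D\<close> uses it.\<close>

lemma nn_integral_two_point_off_cluster_finite:
  fixes E :: "'d::finite edge set"
    and S \<Lambda> D :: "'d lattice set"
    and a u v x :: "'d lattice"
  assumes e: "(u, v) \<in> exit_edges E S" and p: "0 \<le> p" "p \<le> 1" and "S \<subseteq> \<Lambda>" "finite D" "D \<subseteq> \<Lambda>"
  defines "f \<equiv> \<lambda>\<omega>. indicator {\<omega>. connected_in E \<omega> S a u} \<omega> *
      ennreal (p * two_point E (D - cluster (E - {{u, v}}) \<omega> a \<Lambda>) p v x)"
  shows "f \<in> borel_measurable (percolation E p)"
    and "(\<integral>\<^sup>+\<omega>. f \<omega> \<partial>percolation E p) \<le>
      emeasure (percolation E p) {\<omega> \<in> space (percolation E p). exit_bridge E S \<Lambda> a x (u, v) \<omega>}"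
proof -
  let ?M = "percolation E p"
  interpret prob_space ?M by (rule prob_space_percolation)
  from e have uv: "{u, v} \<in> E" "v \<notin> S" by (auto simp: exit_edges_def)
  define F where "F = explored (E - {{u, v}}) S \<Lambda> D a u"
  define G where "G = (\<lambda>B \<omega>. connected_in E \<omega> (D - B) v x \<and> \<omega> {u, v} \<and> F B \<omega>)"
  have S_e: "connected_in (E - {{u, v}}) \<omega> S = connected_in E \<omega> S" for \<omega>
    using uv(2) by (intro connected_in_cong) auto
  have F: "Measurable.pred ?M (F B)" for B
    unfolding F_def by (rule pred_explored) auto
  then have F_sets: "{\<omega> \<in> space ?M. F B \<omega>} \<in> sets ?M" for B by (simp add: pred_def)
  have "Measurable.pred ?M (G B)" for B
    unfolding G_def by (intro pred_intros_logic pred_connected_in pred_edge_open uv F) auto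
  then have G_sets: "{\<omega> \<in> space ?M. G B \<omega>} \<in> sets ?M" for B by (simp add: pred_def)
  have f_eq: "f \<omega> = (\<Sum>B\<in>Pow D. ennreal (p * two_point E (D - B) p v x) *
      indicator {\<omega> \<in> space ?M. F B \<omega>} \<omega>)" if "\<omega> \<in> space ?M" for \<omega>
  proof -
    let ?C = "cluster (E - {{u, v}}) \<omega> a \<Lambda>"
    have "(\<Sum>B\<in>Pow D. ennreal (p * two_point E (D - B) p v x) * indicator {\<omega> \<in> space ?M. F B \<omega>} \<omega>) =
        (\<Sum>B\<in>Pow D. if B = ?C \<inter> D then indicator {\<omega>. connected_in E \<omega> S a u} \<omega> *
            ennreal (p * two_point E (D - B) p v x) else 0)"
      using that by (intro sum.cong) (auto simp: F_def explored_def S_e indicator_def)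
    also have "\<dots> = f \<omega>"
      using \<open>finite D\<close> by (simp add: f_def Diff_Int)
    finally show ?thesis by simp
  qed
  show "f \<in> borel_measurable ?M"
    using F_sets by (subst measurable_cong[OF f_eq]) auto
  have "(\<integral>\<^sup>+\<omega>. f \<omega> \<partial>?M) =
      (\<Sum>B\<in>Pow D. ennreal (p * two_point E (D - B) p v x) * emeasure ?M {\<omega> \<in> space ?M. F B \<omega>})"
    using F_sets by (simp add: f_eq nn_integral_sum nn_integral_cmult_indicator cong: nn_integral_cong)
  also have "\<dots> = (\<Sum>B\<in>Pow D. emeasure ?M {\<omega> \<in> space ?M. G B \<omega>})"
  proof (intro sum.cong refl)
    fix B
    show "ennreal (p * two_point E (D - B) p v x) * emeasure ?M {\<omega> \<in> space ?M. F B \<omega>} =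
        emeasure ?M {\<omega> \<in> space ?M. G B \<omega>}"
      unfolding G_def emeasure_eq_measure F_def
      using p prob_explored_bridge[OF uv(1) p \<open>S \<subseteq> \<Lambda>\<close>, where D = D and B = B and x = x and a = a]
      by (simp add: ennreal_mult'[symmetric] mult_ac two_point_def)
  qed
  also have "\<dots> = emeasure ?M (\<Union>B\<in>Pow D. {\<omega> \<in> space ?M. G B \<omega>})"
    using G_sets \<open>finite D\<close>
    by (intro sum_emeasure) (auto simp: disjoint_family_on_def G_def F_def explored_def)
  also have "\<dots> \<le> emeasure ?M {\<omega> \<in> space ?M. exit_bridge E S \<Lambda> a x (u, v) \<omega>}"
  proof (rule emeasure_mono)
    show "{\<omega> \<in> space ?M. exit_bridge E S \<Lambda> a x (u, v) \<omega>} \<in> sets ?M"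
      by (rule sets_exit_bridge(1)[OF e])
    have "exit_bridge E S \<Lambda> a x (u, v) \<omega>" if "G B \<omega>" for B \<omega>
    proof -
      from that have "D - B \<subseteq> \<Lambda> - cluster (E - {{u, v}}) \<omega> a \<Lambda>"
        using \<open>D \<subseteq> \<Lambda>\<close> by (auto simp: G_def F_def explored_def)
      moreover from that have "connected_in E \<omega> (D - B) v x" by (simp add: G_def)
      ultimately have "connected_in E \<omega> (\<Lambda> - cluster (E - {{u, v}}) \<omega> a \<Lambda>) v x"
        by (auto elim!: connected_in_mono)
      with that show ?thesis
        by (simp add: exit_bridge_def G_def F_def explored_def S_e)
    qed
    then show "(\<Union>B\<in>Pow D. {\<omega> \<in> space ?M. G B \<omega>}) \<subseteq>
        {\<omega> \<in> space ?M. exit_bridge E S \<Lambda> a x (u, v) \<omega>}" by auto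
  qed
  finally show "(\<integral>\<^sup>+\<omega>. f \<omega> \<partial>?M) \<le> emeasure ?M {\<omega> \<in> space ?M. exit_bridge E S \<Lambda> a x (u, v) \<omega>}" .
qed

text \<open>Only the set \<open>D\<close> in which \<open>v\<close> is connected to \<open>x\<close> is exhausted by finite sets; the cluster is
  taken in the whole of \<open>\<Lambda>\<close> throughout, so the integrands increase with \<open>D\<close>.\<close>

lemma nn_integral_two_point_off_cluster:
  fixes \<Lambda> :: "'d::finite lattice set"
  assumes e: "(u, v) \<in> exit_edges E S" and p: "0 \<le> p" "p \<le> 1" and "S \<subseteq> \<Lambda>"
  shows "(\<integral>\<^sup>+\<omega>. indicator {\<omega>. connected_in E \<omega> S a u} \<omega> *
        ennreal (p * two_point E (\<Lambda> - cluster (E - {{u, v}}) \<omega> a \<Lambda>) p v x) \<partial>percolation E p) \<le>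
      emeasure (percolation E p) {\<omega> \<in> space (percolation E p). exit_bridge E S \<Lambda> a x (u, v) \<omega>}"
    (is "_ \<le> ?b")
proof -
  let ?M = "percolation E p"
  let ?f = "\<lambda>A \<omega>. indicator {\<omega>. connected_in E \<omega> S a u} \<omega> *
        ennreal (p * two_point E (A - cluster (E - {{u, v}}) \<omega> a \<Lambda>) p v x)"
  define D where "D n = {y \<in> \<Lambda>. to_nat y \<le> n}" for n
  have D: "finite (D n)" "D n \<subseteq> \<Lambda>" for n
  proof -
    have "finite (to_nat -` {..n} :: 'd lattice set)" by (rule finite_vimageI) auto
    then show "finite (D n)" by (rule rev_finite_subset) (auto simp: D_def)
  qed (auto simp: D_def)
  have "?f \<Lambda> \<omega> = (SUP n. ?f (D n) \<omega>)" for \<omega>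
  proof -
    let ?C = "cluster (E - {{u, v}}) \<omega> a \<Lambda>"
    have "incseq (\<lambda>n. D n - ?C)" by (force simp: incseq_def D_def)
    moreover have "(\<Union>n. D n - ?C) = \<Lambda> - ?C" by (auto simp: D_def)
    ultimately have "ennreal (two_point E (\<Lambda> - ?C) p v x) =
        (SUP n. ennreal (two_point E (D n - ?C) p v x))"
      by (metis two_point_UN_incseq)
    then show ?thesis
      using p by (simp add: ennreal_mult' SUP_mult_left_ennreal)
  qed
  moreover have "incseq (\<lambda>n. ?f (D n))"
    using p
    by (auto simp: incseq_def D_def le_fun_def intro!: mult_left_mono ennreal_leI two_point_mono)
  ultimately have "(\<integral>\<^sup>+\<omega>. ?f \<Lambda> \<omega> \<partial>?M) = (SUP n. \<integral>\<^sup>+\<omega>. ?f (D n) \<omega> \<partial>?M)"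
    using nn_integral_two_point_off_cluster_finite(1)[OF e p \<open>S \<subseteq> \<Lambda>\<close> D]
    by (simp add: nn_integral_monotone_convergence_SUP)
  also have "\<dots> \<le> ?b"
    by (intro SUP_least nn_integral_two_point_off_cluster_finite(2)[OF e p \<open>S \<subseteq> \<Lambda>\<close> D])
  finally show ?thesis .
qed

section \<open>Comparison with the exit bridge probabilities\<close>

text \<open>If \<open>g\<close> is not integrable, in particular if it is not measurable, its Bochner integral is \<open>0\<close>.\<close>

lemma ennreal_integral_le_nn_integral:
  assumes "\<And>\<omega>. 0 \<le> g \<omega>"
  shows "ennreal (\<integral>\<omega>. g \<omega> \<partial>M) \<le> (\<integral>\<^sup>+\<omega>. ennreal (g \<omega>) \<partial>M)"
  using assms by (cases "integrable M g")
    (auto simp: nn_integral_eq_integral not_integrable_integral_eq)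

text \<open>When \<open>a\<close> is connected to \<open>u\<close>, both have the same cluster in \<open>\<Lambda>\<close>. Deleting \<open>{u, v}\<close> can only
  shrink it, which enlarges its complement and hence the two-point function there.\<close>

lemma integral_le_emeasure_exit_bridge:
  assumes e: "(u, v) \<in> exit_edges E S" and p: "0 \<le> p" "p \<le> 1" and "S \<subseteq> \<Lambda>"
  shows "ennreal (\<integral>\<omega>. indicator {\<omega>. connected_in E \<omega> S a u} \<omega> * p *
        two_point E (\<Lambda> - cluster E \<omega> u \<Lambda>) p v x \<partial>percolation E p) \<le>
      emeasure (percolation E p) {\<omega> \<in> space (percolation E p). exit_bridge E S \<Lambda> a x (u, v) \<omega>}"
proof -
  let ?M = "percolation E p"
  let ?I = "\<lambda>\<omega>. indicator {\<omega>. connected_in E \<omega> S a u} \<omega>"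
  have cluster: "cluster (E - {{u, v}}) \<omega> a \<Lambda> \<subseteq> cluster E \<omega> u \<Lambda>" if "connected_in E \<omega> S a u" for \<omega>
  proof
    fix y
    assume "y \<in> cluster (E - {{u, v}}) \<omega> a \<Lambda>"
    then have "connected_in E \<omega> \<Lambda> a y" by (auto simp: cluster_def elim!: connected_in_mono)
    moreover have "connected_in E \<omega> \<Lambda> a u"
      using that by (rule connected_in_mono) (use \<open>S \<subseteq> \<Lambda>\<close> in auto)
    then have "connected_in E \<omega> \<Lambda> u a" by (rule connected_in_sym)
    ultimately show "y \<in> cluster E \<omega> u \<Lambda>"
      by (auto simp: cluster_def intro: connected_in_trans)
  qed
  have "ennreal (\<integral>\<omega>. ?I \<omega> * p * two_point E (\<Lambda> - cluster E \<omega> u \<Lambda>) p v x \<partial>?M) \<le>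
      (\<integral>\<^sup>+\<omega>. ennreal (?I \<omega> * p * two_point E (\<Lambda> - cluster E \<omega> u \<Lambda>) p v x) \<partial>?M)"
    using p by (intro ennreal_integral_le_nn_integral) (auto simp: two_point_def)
  also have "\<dots> \<le> (\<integral>\<^sup>+\<omega>. ?I \<omega> *
      ennreal (p * two_point E (\<Lambda> - cluster (E - {{u, v}}) \<omega> a \<Lambda>) p v x) \<partial>?M)"
  proof (rule nn_integral_mono)
    fix \<omega>
    show "ennreal (?I \<omega> * p * two_point E (\<Lambda> - cluster E \<omega> u \<Lambda>) p v x) \<le>
        ?I \<omega> * ennreal (p * two_point E (\<Lambda> - cluster (E - {{u, v}}) \<omega> a \<Lambda>) p v x)"
    proof (cases "connected_in E \<omega> S a u")
      case True
      have "two_point E (\<Lambda> - cluster E \<omega> u \<Lambda>) p v x \<le>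
          two_point E (\<Lambda> - cluster (E - {{u, v}}) \<omega> a \<Lambda>) p v x"
        by (intro two_point_mono Diff_mono order_refl cluster True)
      with True p show ?thesis by (simp add: ennreal_leI mult_left_mono)
    qed simp
  qed
  also have "\<dots> \<le> emeasure ?M {\<omega> \<in> space ?M. exit_bridge E S \<Lambda> a x (u, v) \<omega>}"
    by (rule nn_integral_two_point_off_cluster[OF assms])
  finally show ?thesis .
qed

lemma infsum_exit_edges_le:
  assumes p: "0 \<le> p" "p \<le> 1" and "S \<subseteq> \<Lambda>"
  shows "(\<Sum>\<^sub>\<infinity>(u, v)\<in>exit_edges E S.
        ennreal (\<integral>\<omega>. indicator {\<omega>. connected_in E \<omega> S a u} \<omega> * p *
                        two_point E (\<Lambda> - cluster E \<omega> u \<Lambda>) p v x \<partial>percolation E p)) \<le>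
    emeasure (percolation E p)
      {\<omega> \<in> space (percolation E p). \<exists>uv\<in>exit_edges E S. exit_bridge E S \<Lambda> a x uv \<omega>}"
    (is "infsum ?g _ \<le> emeasure ?M ?U")
proof (rule infsum_le_finite_sums)
  show "?g summable_on exit_edges E S" by (intro nonneg_summable_on_complete) auto
  let ?X = "\<lambda>uv. {\<omega> \<in> space ?M. exit_bridge E S \<Lambda> a x uv \<omega>}"
  fix P
  assume P: "finite P" "P \<subseteq> exit_edges E S"
  have "sum ?g P \<le> (\<Sum>uv\<in>P. emeasure ?M (?X uv))"
    using P integral_le_emeasure_exit_bridge[OF _ p \<open>S \<subseteq> \<Lambda>\<close>] by (intro sum_mono) auto
  also have "\<dots> = emeasure ?M (\<Union>uv\<in>P. ?X uv)"
  proof (rule sum_emeasure)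
    show "?X ` P \<subseteq> sets ?M" using P by (auto intro: sets_exit_bridge)
    have "uv' = uv" if "uv \<in> P" "uv' \<in> P" "exit_bridge E S \<Lambda> a x uv \<omega>" "exit_bridge E S \<Lambda> a x uv' \<omega>"
      for uv uv' \<omega>
      using that P(2) exit_bridge_unique[OF _ _ \<open>S \<subseteq> \<Lambda>\<close>] by (cases uv; cases uv') blast
    then show "disjoint_family_on ?X P" unfolding disjoint_family_on_def by blast
  qed (rule P)
  also have "\<dots> \<le> emeasure ?M ?U"
    by (rule emeasure_mono[OF _ sets_exit_bridge(2)]) (use P in auto)
  finally show "sum ?g P \<le> emeasure ?M ?U" .
qed

text \<open>A connection inside \<open>S\<close> and the existence of an exit bridge exclude each other, and each
  implies the connection in \<open>\<Lambda>\<close>.\<close>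

theorem theorem1p2:
  fixes \<E> :: "'d::finite edge set"
    and S \<Lambda> :: "'d lattice set"
    and p :: real
    and a x :: "'d lattice"
  assumes "CARD('d) \<ge> 2"
    and "admissible_edges \<E>"
    and "S \<subseteq> \<Lambda>"
    and "0 < p" and "p < 1"
    and "a \<in> S" and "x \<in> \<Lambda>"
  shows "ennreal (two_point \<E> \<Lambda> p a x) \<ge>
           ennreal (two_point \<E> S p a x) +
           (\<Sum>\<^sub>\<infinity>(u, v)\<in>{(u, v). u \<in> S \<and> v \<notin> S \<and> {u, v} \<in> \<E>}.
              ennreal (\<integral>\<omega>. indicator {\<omega>. connected_in \<E> \<omega> S a u} \<omega> * p *
                              two_point \<E> (\<Lambda> - cluster \<E> \<omega> u \<Lambda>) p v x
                        \<partial>percolation \<E> p))"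
proof -
  let ?M = "percolation \<E> p"
  let ?T = "\<lambda>S. {\<omega> \<in> space ?M. connected_in \<E> \<omega> S a x}"
  let ?U = "{\<omega> \<in> space ?M. \<exists>uv\<in>exit_edges \<E> S. exit_bridge \<E> S \<Lambda> a x uv \<omega>}"
  let ?g = "\<lambda>(u, v). ennreal (\<integral>\<omega>. indicator {\<omega>. connected_in \<E> \<omega> S a u} \<omega> * p *
                              two_point \<E> (\<Lambda> - cluster \<E> \<omega> u \<Lambda>) p v x \<partial>?M)"
  have T: "?T S \<in> sets ?M" for S
    using pred_connected_in[where E = \<E> and E' = \<E> and p = p] by (simp add: pred_def)
  have "infsum ?g (exit_edges \<E> S) \<le> emeasure ?M ?U"
    using assms by (intro infsum_exit_edges_le) auto
  then have "ennreal (two_point \<E> S p a x) + infsum ?g (exit_edges \<E> S) \<le>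
      emeasure ?M (?T S) + emeasure ?M ?U"
    by (simp add: emeasure_connected_in)
  also have "\<dots> = emeasure ?M (?T S \<union> ?U)"
  proof (rule plus_emeasure[OF T sets_exit_bridge(2)])
    have "\<not> exit_bridge \<E> S \<Lambda> a x (u, v) \<omega>"
      if "connected_in \<E> \<omega> S a x" "(u, v) \<in> exit_edges \<E> S" for u v \<omega>
      using that connected_in_Diff_exit_edge[OF that(1) _ \<open>S \<subseteq> \<Lambda>\<close>, of v u]
      by (auto simp: exit_edges_def dest: exit_bridge_imp_not_in_cluster)
    then show "?T S \<inter> ?U = {}" by fast
  qed
  also have "\<dots> \<le> emeasure ?M (?T \<Lambda>)"
  proof (rule emeasure_mono[OF _ T])
    have "connected_in \<E> \<omega> \<Lambda> a x" if "connected_in \<E> \<omega> S a x" for \<omega>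
      using that \<open>S \<subseteq> \<Lambda>\<close> by (auto elim!: connected_in_mono)
    moreover have "connected_in \<E> \<omega> \<Lambda> a x"
      if "(u, v) \<in> exit_edges \<E> S" "exit_bridge \<E> S \<Lambda> a x (u, v) \<omega>" for u v \<omega>
      using exit_bridge_imp_connected[OF that(2) _ \<open>S \<subseteq> \<Lambda>\<close>] that(1) by (auto simp: exit_edges_def)
    ultimately show "?T S \<union> ?U \<subseteq> ?T \<Lambda>" by fast
  qed
  finally show ?thesis
    by (simp add: emeasure_connected_in exit_edges_def)
qed

end
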